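(* Let $\mathbf k$ be a field of characteristic $0$, $\lambda\in\mathbf k$, and let $(\mathfrak g,d_{\mathfrak g})$ be a differential Lie algebra of weight $\lambda$. If $\tilde{\mathrm H}^2_{\mathrm{DL}_\lambda}(\mathfrak g,\mathfrak g_{\mathrm{ad}})=0$, then $(\mathfrak g,d_{\mathfrak g})$ is rigid.
   Context: A differential Lie algebra of weight $\lambda$ is a Lie algebra $\mathfrak g$ (bracket $\mu_{\mathfrak g}=[\,,]$) with a linear map $d_{\mathfrak g}$ such that $d_{\mathfrak g}([x,y])=[d_{\mathfrak g}(x),y]+[x,d_{\mathfrak g}(y)]+\lambda[d_{\mathfrak g}(x),d_{\mathfrak g}(y)]$. A $1$-parameter formal deformation is a pair $\mu_t=\sum_{i\ge0}\mu_it^i$, $d_t=\sum_{i\ge0}d_it^i$, $\mu_i\in\mathrm{Hom}(\wedge^2\mathfrak g,\mathfrak g)$, $d_i\in\mathrm{Hom}(\mathfrak g,\mathfrak g)$, making $\mathfrak g[[t]]$ a differential Lie algebra of weight $\lambda$ over $\mathbf k[[t]]$, with $(\mu_0,d_0)=(\mu_{\mathfrak g},d_{\mathfrak g})$. It is trivial if there is $\Phi_t=\sum_{i\ge0}\phi_it^i$, $\phi_i:\mathfrak g\to\mathfrak g$ linear, $\phi_0=\mathrm{Id}$, with $\Phi_t\circ\mu_t=\mu_{\mathfrak g}\circ(\Phi_t\times\Phi_t)$ and $\Phi_t\circ d_t=d_{\mathfrak g}\circ\Phi_t$ (where $\mu_{\mathfrak g},d_{\mathfrak g}$ are extended $\mathbf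 k[[t]]$-linearly). $(\mathfrak g,d_{\mathfrak g})$ is rigid if every $1$-parameter formal deformation of it is trivial. Adjoint representation: $V=\mathfrak g$, $\rho(x)=[x,-]$, $d_V=d_{\mathfrak g}$; $\rho_\lambda(x)=\rho(x+\lambda d_{\mathfrak g}(x))$. For $f\in\mathrm{Hom}(\wedge^n\mathfrak g,V)$, $$\partial^n_{\mathrm{Lie}}(f)(x_1,\dots,x_{n+1})=\sum_{i}(-1)^{i+n}\rho(x_i)f(x_1,\dots,\hat x_i,\dots,x_{n+1})+\sum_{i<j}(-1)^{i+j+n+1}f([x_i,x_j],x_1,\dots,\hat x_i,\dots,\hat x_j,\dots,x_{n+1}),$$ $\partial^n_{\mathrm{DO}_\lambda}$ is the same with $\rho_\lambda$ in place of $\rho$, and $$\delta^nf(x_1,\dots,x_n)=\sum_{k=1}^n\lambda^{k-1}\sum_{i_1<\dots<i_k}f(x_1,\dots,d_{\mathfrak g}(x_{i_1}),\dots,d_{\mathfrak g}(x_{i_k}),\dots,x_n)-d_Vf(x_1,\dots,x_n).$$ The complex $\tilde{\mathrm C}^*_{\mathrm{DL}_\lambda}(\mathfrak g,V)$ is $0$ in degree $0$, $\mathrm{Hom}(\mathfrak g,V)$ in degree $1$, and $\mathrm{Hom}(\wedge^n\mathfrak g,V)\oplus\mathrm{Hom}(\wedge^{n-1}\mathfrak g,V)$ for $n\ge2$, with differential $\partial^n_{\mathrm{DL}_\lambda}(f,g)=(\partial^n_{\mathrm{Lie}}f,-\partial^{n-1}_{\mathrm{DO}_\lambda}g-\delta^nf)$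 (with $g=0$ when $n=1$). Its cohomology is $\tilde{\mathrm H}^*_{\mathrm{DL}_\lambda}(\mathfrak g,V)$. *)

theory Defs
  imports "HOL-Computational_Algebra.Formal_Power_Series" "HOL-Library.Function_Algebras"
    "HOL-Library.Product_Plus"
begin

section \<open>Differential Lie algebras of weight lambda\<close>

text \<open>The ground ring is an arbitrary commutative ring, so that the same notion applies to a
  vector space over the field $k$ and to a module over $k[[t]]$.\<close>

definition alt_bilinear ::
    "('r::comm_ring_1 \<Rightarrow> 'a::ab_group_add \<Rightarrow> 'a) \<Rightarrow> ('a \<Rightarrow> 'a \<Rightarrow> 'a) \<Rightarrow> bool" where
  "alt_bilinear scale m \<longleftrightarrow>
     (\<forall>x. module_hom scale scale (m x)) \<and>
     (\<forall>y. module_hom scale scale (\<lambda>x. m x y)) \<and>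
     (\<forall>x. m x x = 0)"

locale lie_algebra = module scale
  for scale :: "'r::comm_ring_1 \<Rightarrow> 'a::ab_group_add \<Rightarrow> 'a" +
  fixes bracket :: "'a \<Rightarrow> 'a \<Rightarrow> 'a"
  assumes alt_bilinear_bracket: "alt_bilinear scale bracket"
    and jacobi:
      "bracket x (bracket y z) + bracket y (bracket z x) + bracket z (bracket x y) = 0"

locale differential_lie_algebra = lie_algebra scale bracket
  for scale :: "'r::comm_ring_1 \<Rightarrow> 'a::ab_group_add \<Rightarrow> 'a" and bracket +
  fixes lam :: 'r and d :: "'a \<Rightarrow> 'a"
  assumes linear_d: "module_hom scale scale d"
    and d_bracket:
      "d (bracket x y) = bracket (d x) y + bracket x (d y) + scale lam (bracket (d x) (d y))"

section \<open>Formal deformations and rigidity\<close>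

text \<open>The $k[[t]]$-module $g[[t]]$ is the type of power series with coefficients in $g$,
  with the convolution action of $k[[t]]$.\<close>

definition fps_scale ::
    "('k::comm_ring_1 \<Rightarrow> 'g::ab_group_add \<Rightarrow> 'g) \<Rightarrow> 'k fps \<Rightarrow> 'g fps \<Rightarrow> 'g fps" where
  "fps_scale scale c x = Abs_fps (\<lambda>n. \<Sum>i\<le>n. scale (fps_nth c i) (fps_nth x (n - i)))"

text \<open>The maps on $g[[t]]$ given by the formal series $\sum_i f_i t^i$ and
  $\sum_i \mu_i t^i$ of linear, respectively bilinear, maps on $g$.\<close>

definition linear_series ::
    "(nat \<Rightarrow> 'g::ab_group_add \<Rightarrow> 'g) \<Rightarrow> 'g fps \<Rightarrow> 'g fps" where
  "linear_series f x = Abs_fps (\<lambda>n. \<Sum>i\<le>n. f i (fps_nth x (n - i)))"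

definition bilinear_series ::
    "(nat \<Rightarrow> 'g::ab_group_add \<Rightarrow> 'g \<Rightarrow> 'g) \<Rightarrow> 'g fps \<Rightarrow> 'g fps \<Rightarrow> 'g fps" where
  "bilinear_series \<mu> x y =
     Abs_fps (\<lambda>n. \<Sum>i\<le>n. \<Sum>j\<le>n - i. \<mu> i (fps_nth x j) (fps_nth y (n - i - j)))"

definition extend_linear :: "('g::ab_group_add \<Rightarrow> 'g) \<Rightarrow> 'g fps \<Rightarrow> 'g fps" where
  "extend_linear f = linear_series (\<lambda>i. if i = 0 then f else 0)"

definition extend_bilinear :: "('g::ab_group_add \<Rightarrow> 'g \<Rightarrow> 'g) \<Rightarrow> 'g fps \<Rightarrow> 'g fps \<Rightarrow> 'g fps" where
  "extend_bilinear m = bilinear_series (\<lambda>i. if i = 0 then m else 0)"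

definition formal_deformation ::
    "('k::field \<Rightarrow> 'g::ab_group_add \<Rightarrow> 'g) \<Rightarrow> ('g \<Rightarrow> 'g \<Rightarrow> 'g) \<Rightarrow> 'k \<Rightarrow> ('g \<Rightarrow> 'g) \<Rightarrow>
     (nat \<Rightarrow> 'g \<Rightarrow> 'g \<Rightarrow> 'g) \<Rightarrow> (nat \<Rightarrow> 'g \<Rightarrow> 'g) \<Rightarrow> bool" where
  "formal_deformation scale bracket lam d \<mu>t dt \<longleftrightarrow>
     (\<forall>i. alt_bilinear scale (\<mu>t i)) \<and>
     (\<forall>i. module_hom scale scale (dt i)) \<and>
     differential_lie_algebra (fps_scale scale) (bilinear_series \<mu>t) (fps_const lam)
       (linear_series dt) \<and>
     \<mu>t 0 = bracket \<and> dt 0 = d"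

definition trivial_deformation ::
    "('k::field \<Rightarrow> 'g::ab_group_add \<Rightarrow> 'g) \<Rightarrow> ('g \<Rightarrow> 'g \<Rightarrow> 'g) \<Rightarrow> ('g \<Rightarrow> 'g) \<Rightarrow>
     (nat \<Rightarrow> 'g \<Rightarrow> 'g \<Rightarrow> 'g) \<Rightarrow> (nat \<Rightarrow> 'g \<Rightarrow> 'g) \<Rightarrow> bool" where
  "trivial_deformation scale bracket d \<mu>t dt \<longleftrightarrow>
     (\<exists>\<phi>. (\<forall>i. module_hom scale scale (\<phi> i)) \<and> \<phi> 0 = id \<and>
        (\<forall>x y. linear_series \<phi> (bilinear_series \<mu>t x y) =
               extend_bilinear bracket (linear_series \<phi> x) (linear_series \<phi> y)) \<and>
        (\<forall>x. linear_series \<phi> (linear_series dt x) = extend_linear d (linear_series \<phi> x)))"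

definition rigid ::
    "('k::field \<Rightarrow> 'g::ab_group_add \<Rightarrow> 'g) \<Rightarrow> ('g \<Rightarrow> 'g \<Rightarrow> 'g) \<Rightarrow> 'k \<Rightarrow> ('g \<Rightarrow> 'g) \<Rightarrow> bool" where
  "rigid scale bracket lam d \<longleftrightarrow>
     (\<forall>\<mu>t dt. formal_deformation scale bracket lam d \<mu>t dt \<longrightarrow>
        trivial_deformation scale bracket d \<mu>t dt)"

section \<open>The cochain complex with coefficients in the adjoint representation\<close>

text \<open>An element of $Hom(\wedge^n g, g)$ is an alternating multilinear function on lists of
  length \<open>n\<close>, extended by zero to all other lists so that distinct functions are distinct
  cochains.\<close>

definition alt_maps ::
    "('k::field \<Rightarrow> 'g::ab_group_add \<Rightarrow> 'g) \<Rightarrow> nat \<Rightarrow> ('g list \<Rightarrow> 'g) set" where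
  "alt_maps scale n = {f.
     (\<forall>xs i. length xs = n \<longrightarrow> i < n \<longrightarrow> module_hom scale scale (\<lambda>x. f (xs[i := x]))) \<and>
     (\<forall>xs i j. length xs = n \<longrightarrow> i < j \<longrightarrow> j < n \<longrightarrow> xs ! i = xs ! j \<longrightarrow> f xs = 0) \<and>
     (\<forall>xs. length xs \<noteq> n \<longrightarrow> f xs = 0)}"

text \<open>Chevalley--Eilenberg differential for an action \<open>\<rho>\<close>. Positions are counted from 0, which
  changes the exponent of the first sign from $i+n$ to $i+1+n$ and leaves the parity of the
  exponent $i+j+n+1$ of the second one unchanged.\<close>

definition ce_diff ::
    "('k::field \<Rightarrow> 'g::ab_group_add \<Rightarrow> 'g) \<Rightarrow> ('g \<Rightarrow> 'g \<Rightarrow> 'g) \<Rightarrow> ('g \<Rightarrow> 'g \<Rightarrow> 'g) \<Rightarrow>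
     nat \<Rightarrow> ('g list \<Rightarrow> 'g) \<Rightarrow> 'g list \<Rightarrow> 'g" where
  "ce_diff scale bracket \<rho> n f xs =
     (if length xs = n + 1 then
        (\<Sum>i<n + 1. scale ((- 1) ^ (i + 1 + n)) (\<rho> (xs ! i) (f (nths xs (- {i}))))) +
        (\<Sum>j<n + 1. \<Sum>i<j. scale ((- 1) ^ (i + j + n + 1))
           (f (bracket (xs ! i) (xs ! j) # nths xs (- {i, j}))))
      else 0)"

definition lie_diff where
  "lie_diff scale bracket = ce_diff scale bracket bracket"

definition do_diff where
  "do_diff scale bracket lam d =
     ce_diff scale bracket (\<lambda>x. bracket (x + scale lam (d x)))"

definition delta ::
    "('k::field \<Rightarrow> 'g::ab_group_add \<Rightarrow> 'g) \<Rightarrow> 'k \<Rightarrow> ('g \<Rightarrow> 'g) \<Rightarrow>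
     nat \<Rightarrow> ('g list \<Rightarrow> 'g) \<Rightarrow> 'g list \<Rightarrow> 'g" where
  "delta scale lam d n f xs =
     (if length xs = n then
        (\<Sum>k = 1..n. scale (lam ^ (k - 1))
           (\<Sum>I | I \<subseteq> {..<n} \<and> card I = k.
              f (map (\<lambda>i. if i \<in> I then d (xs ! i) else xs ! i) [0..<n])))
        - d (f xs)
      else 0)"

text \<open>In degree 1 the second component is zero, i.e. $Hom(\wedge^0 g, g)$ is omitted.\<close>

definition DL_cochains ::
    "('k::field \<Rightarrow> 'g::ab_group_add \<Rightarrow> 'g) \<Rightarrow> nat \<Rightarrow> (('g list \<Rightarrow> 'g) \<times> ('g list \<Rightarrow> 'g)) set" where
  "DL_cochains scale n =
     (if n = 0 then {0}
      else if n = 1 then alt_maps scale 1 \<times> {0}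
      else alt_maps scale n \<times> alt_maps scale (n - 1))"

text \<open>The truncated \<open>n - 1\<close> at \<open>n = 0\<close> is harmless: the only cochain there is zero.\<close>

definition DL_diff ::
    "('k::field \<Rightarrow> 'g::ab_group_add \<Rightarrow> 'g) \<Rightarrow> ('g \<Rightarrow> 'g \<Rightarrow> 'g) \<Rightarrow> 'k \<Rightarrow> ('g \<Rightarrow> 'g) \<Rightarrow> nat \<Rightarrow>
     ('g list \<Rightarrow> 'g) \<times> ('g list \<Rightarrow> 'g) \<Rightarrow> ('g list \<Rightarrow> 'g) \<times> ('g list \<Rightarrow> 'g)" where
  "DL_diff scale bracket lam d n = (\<lambda>(f, g).
     (lie_diff scale bracket n f,
      - do_diff scale bracket lam d (n - 1) g - delta scale lam d n f))"

definition DL_cocycles where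
  "DL_cocycles scale bracket lam d n =
     {c \<in> DL_cochains scale n. DL_diff scale bracket lam d n c = 0}"

definition DL_coboundaries where
  "DL_coboundaries scale bracket lam d n =
     (if n = 0 then {0} else DL_diff scale bracket lam d (n - 1) ` DL_cochains scale (n - 1))"

text \<open>The quotient of cocycles by coboundaries, as a set of cosets; its zero element is the
  coset \<open>DL_coboundaries\<close>.\<close>

definition DL_cohomology ::
    "('k::field \<Rightarrow> 'g::ab_group_add \<Rightarrow> 'g) \<Rightarrow> ('g \<Rightarrow> 'g \<Rightarrow> 'g) \<Rightarrow> 'k \<Rightarrow> ('g \<Rightarrow> 'g) \<Rightarrow> nat \<Rightarrow>
     (('g list \<Rightarrow> 'g) \<times> ('g list \<Rightarrow> 'g)) set set" where
  "DL_cohomology scale bracket lam d n =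
     (\<lambda>z. (+) z ` DL_coboundaries scale bracket lam d n) ` DL_cocycles scale bracket lam d n"

end

theory Submission
  imports Defs
begin

text \<open>The equivalence \<open>\<Phi>\<^sub>t\<close> is built one coefficient at a time. Suppose \<open>\<phi>\<^sub>0, \<dots>, \<phi>\<^sub>n\<^sub>-\<^sub>1\<close> make
  \<open>E = \<Phi>\<^sub>t \<circ> \<mu>\<^sub>t - [,] \<circ> (\<Phi>\<^sub>t \<times> \<Phi>\<^sub>t)\<close> and \<open>G = \<Phi>\<^sub>t \<circ> d\<^sub>t - d \<circ> \<Phi>\<^sub>t\<close> vanish below order \<open>n\<close>.
  Applying \<open>\<Phi>\<^sub>t\<close> to the Jacobi and derivation identities of the deformation and moving it inwards,
  the terms free of \<open>E\<close> and \<open>G\<close> cancel by the identities of the undeformed algebra, and the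
  coefficient of \<open>t\<^sup>n\<close> of what remains says that \<open>(E\<^sub>n, G\<^sub>n)\<close> is a 2-cocycle. It is therefore the
  coboundary of some linear \<open>a\<close>, and \<open>\<phi>\<^sub>n = a\<close> makes both defects vanish in order \<open>n\<close>. The inverse of
  \<open>\<Phi>\<^sub>t\<close> and infinite compositions of equivalences are not needed.\<close>

unbundle fps_syntax

section \<open>Series of additive maps\<close>

lemma linear_series_nth: "linear_series f x $ n = (\<Sum>i\<le>n. f i (x $ (n - i)))"
  by (simp add: linear_series_def)

lemma bilinear_series_nth:
  "bilinear_series m x y $ n = (\<Sum>i\<le>n. \<Sum>j\<le>n - i. m i (x $ j) (y $ (n - i - j)))"
  by (simp add: bilinear_series_def)

lemma extend_linear_nth: "extend_linear f x $ n = f (x $ n)"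
proof -
  have "extend_linear f x $ n = (\<Sum>i\<le>n. if i = 0 then f (x $ (n - i)) else 0)"
    unfolding extend_linear_def linear_series_nth by (intro sum.cong) auto
  then show ?thesis by simp
qed

lemma extend_bilinear_nth: "extend_bilinear m x y $ n = (\<Sum>j\<le>n. m (x $ j) (y $ (n - j)))"
proof -
  have "extend_bilinear m x y $ n =
      (\<Sum>i\<le>n. if i = 0 then \<Sum>j\<le>n - i. m (x $ j) (y $ (n - i - j)) else 0)"
    unfolding extend_bilinear_def bilinear_series_nth by (intro sum.cong) auto
  then show ?thesis by simp
qed

lemma fps_scale_const_nth:
  assumes "module scale"
  shows "fps_scale scale (fps_const c) x $ n = scale c (x $ n)"
proof -
  interpret module scale by fact
  have "fps_scale scale (fps_const c) x $ n = (\<Sum>i\<le>n. if i = 0 then scale c (x $ (n - i)) else 0)"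
    unfolding fps_scale_def fps_nth_Abs_fps by (intro sum.cong) auto
  then show ?thesis by simp
qed

text \<open>Reindexing by \<open>k = i + j\<close> collects the terms by the total order in
  \<open>t\<close> contributed by the two series of maps, so a composite is again a single series of
  maps.\<close>

lemma linear_series_linear_series:
  assumes "\<And>i. additive (f i)"
  shows "linear_series f (linear_series g x) = linear_series (\<lambda>n x. \<Sum>i\<le>n. f i (g (n - i) x)) x"
proof (rule fps_ext)
  fix n
  have "(\<Sum>i\<le>n. \<Sum>j\<le>n - i. f i (g j (x $ (n - i - j)))) =
      (\<Sum>k\<le>n. \<Sum>i\<le>k. f i (g (k - i) (x $ (n - k))))"
    unfolding sum.Sigma[OF finite_atMost ballI[OF finite_atMost]] case_prod_beta
    by (rule sum.reindex_bij_witness[of _ "\<lambda>(k, i). (i, k - i)" "\<lambda>(i, j). (i + j, i)"]) auto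
  then show "linear_series f (linear_series g x) $ n =
      linear_series (\<lambda>n x. \<Sum>i\<le>n. f i (g (n - i) x)) x $ n"
    by (simp add: linear_series_nth additive.sum[OF assms])
qed

lemma linear_series_bilinear_series:
  assumes "\<And>i. additive (f i)"
  shows "linear_series f (bilinear_series m x y) =
    bilinear_series (\<lambda>n x y. \<Sum>i\<le>n. f i (m (n - i) x y)) x y"
proof (rule fps_ext)
  fix n
  have "(\<Sum>i\<le>n. \<Sum>j\<le>n - i. \<Sum>k\<le>n - i - j. f i (m j (x $ k) (y $ (n - i - j - k)))) =
      (\<Sum>l\<le>n. \<Sum>k\<le>n - l. \<Sum>i\<le>l. f i (m (l - i) (x $ k) (y $ (n - l - k))))"
    unfolding sum.Sigma[OF finite_atMost ballI[OF finite_atMost]]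
      sum.Sigma[OF finite_atMost ballI[OF finite_SigmaI[OF finite_atMost finite_atMost]]]
      case_prod_beta
    by (rule sum.reindex_bij_witness
        [of _ "\<lambda>(l, k, i). (i, l - i, k)" "\<lambda>(i, j, k). (i + j, k, i)"]) auto
  then show "linear_series f (bilinear_series m x y) $ n =
      bilinear_series (\<lambda>n x y. \<Sum>i\<le>n. f i (m (n - i) x y)) x y $ n"
    by (simp add: linear_series_nth bilinear_series_nth additive.sum[OF assms])
qed

text \<open>Here \<open>l = i + k\<close> is the order contributed by the two copies of
  \<open>f\<close>, and \<open>p\<close> is the order of the coefficient taken from
  \<open>x\<close>. In this form the composite can be subtracted, map by map, from the one in
  \<open>linear_series_bilinear_series\<close>.\<close>

lemma extend_bilinear_linear_series:
  assumes "\<And>x. additive (m x)" and "\<And>y. additive (\<lambda>x. m x y)"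
  shows "extend_bilinear m (linear_series f x) (linear_series f y) =
    bilinear_series (\<lambda>n x y. \<Sum>i\<le>n. m (f i x) (f (n - i) y)) x y"
proof (rule fps_ext)
  fix n
  have "(\<Sum>j\<le>n. \<Sum>k\<le>n - j. \<Sum>i\<le>j. m (f i (x $ (j - i))) (f k (y $ (n - j - k)))) =
      (\<Sum>l\<le>n. \<Sum>p\<le>n - l. \<Sum>i\<le>l. m (f i (x $ p)) (f (l - i) (y $ (n - l - p))))"
    unfolding sum.Sigma[OF finite_atMost ballI[OF finite_atMost]]
      sum.Sigma[OF finite_atMost ballI[OF finite_SigmaI[OF finite_atMost finite_atMost]]]
      case_prod_beta
    by (rule sum.reindex_bij_witness
        [of _ "\<lambda>(l, p, i). (p + i, l - i, i)" "\<lambda>(j, k, i). (i + k, j - i, i)"])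
      (auto simp: add.commute)
  then show "extend_bilinear m (linear_series f x) (linear_series f y) $ n =
      bilinear_series (\<lambda>n x y. \<Sum>i\<le>n. m (f i x) (f (n - i) y)) x y $ n"
    by (simp add: linear_series_nth bilinear_series_nth extend_bilinear_nth
        additive.sum[OF assms(1)] additive.sum[OF assms(2)])
qed

lemma extend_linear_linear_series:
  assumes "additive g"
  shows "extend_linear g (linear_series f x) = linear_series (\<lambda>n x. g (f n x)) x"
  by (rule fps_ext) (simp add: extend_linear_nth linear_series_nth additive.sum[OF assms])

lemma linear_series_diff:
  "linear_series (\<lambda>n x. f n x - g n x) x = linear_series f x - linear_series g x"
  by (rule fps_ext) (simp add: linear_series_nth sum_subtractf)

lemma bilinear_series_diff:
  "bilinear_series (\<lambda>n x y. f n x y - g n x y) x y = bilinear_series f x y - bilinear_series g x y"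
  by (rule fps_ext) (simp add: bilinear_series_nth sum_subtractf)

lemma linear_series_add:
  assumes "\<And>i. additive (f i)"
  shows "linear_series f (x + y) = linear_series f x + linear_series f y"
  by (rule fps_ext) (simp add: linear_series_nth additive.add[OF assms] sum.distrib)

lemma extend_linear_add:
  assumes "additive g"
  shows "extend_linear g (x + y) = extend_linear g x + extend_linear g y"
  by (rule fps_ext) (simp add: extend_linear_nth additive.add[OF assms])

lemma extend_bilinear_add_left:
  assumes "\<And>y. additive (\<lambda>x. m x y)"
  shows "extend_bilinear m (x + x') y = extend_bilinear m x y + extend_bilinear m x' y"
  by (rule fps_ext) (simp add: extend_bilinear_nth additive.add[OF assms] sum.distrib)

lemma extend_bilinear_add_right:
  assumes "\<And>x. additive (m x)"
  shows "extend_bilinear m x (y + y') = extend_bilinear m x y + extend_bilinear m x y'"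
  by (rule fps_ext) (simp add: extend_bilinear_nth additive.add[OF assms] sum.distrib)

section \<open>Lowest-order coefficients\<close>

lemma linear_series_lowest_nth:
  assumes "\<And>i x. i < n \<Longrightarrow> f i x = 0"
  shows "linear_series f x $ n = f n (x $ 0)"
proof -
  have "linear_series f x $ n = (\<Sum>i\<le>n. if i = n then f n (x $ 0) else 0)"
    unfolding linear_series_nth using assms by (intro sum.cong) auto
  then show ?thesis by simp
qed

lemma linear_series_below_nth:
  assumes "\<And>i x. i < n \<Longrightarrow> f i x = 0" and "k < n"
  shows "linear_series f x $ k = 0"
  unfolding linear_series_nth using assms by (intro sum.neutral) auto

lemma bilinear_series_lowest_nth:
  assumes "\<And>i x y. i < n \<Longrightarrow> m i x y = 0"
  shows "bilinear_series m x y $ n = m n (x $ 0) (y $ 0)"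
proof -
  have "bilinear_series m x y $ n = (\<Sum>i\<le>n. if i = n then m n (x $ 0) (y $ 0) else 0)"
    unfolding bilinear_series_nth using assms by (intro sum.cong) auto
  then show ?thesis by simp
qed

lemma bilinear_series_below_nth:
  assumes "\<And>i x y. i < n \<Longrightarrow> m i x y = 0" and "k < n"
  shows "bilinear_series m x y $ k = 0"
  unfolding bilinear_series_nth using assms by (intro sum.neutral ballI) auto

text \<open>When \<open>y\<close> starts in order \<open>n\<close>, every term with
  \<open>j > 0\<close> contains a coefficient of \<open>y\<close> below order \<open>n\<close>, so
  only the constant coefficient of \<open>x\<close> is seen.\<close>

lemma extend_bilinear_lowest_right_nth:
  assumes "\<And>x. additive (m x)" and "\<And>i. i < n \<Longrightarrow> y $ i = 0"
  shows "extend_bilinear m x y $ n = m (x $ 0) (y $ n)"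
proof -
  have "extend_bilinear m x y $ n = (\<Sum>i\<le>n. if i = 0 then m (x $ 0) (y $ n) else 0)"
    unfolding extend_bilinear_nth using assms(2)
    by (intro sum.cong) (auto simp: additive.zero[OF assms(1)])
  then show ?thesis by simp
qed

lemma extend_bilinear_lowest_left_nth:
  assumes "\<And>y. additive (\<lambda>x. m x y)" and "\<And>i. i < n \<Longrightarrow> x $ i = 0"
  shows "extend_bilinear m x y $ n = m (x $ n) (y $ 0)"
proof -
  have "extend_bilinear m x y $ n = (\<Sum>i\<le>n. if i = n then m (x $ n) (y $ 0) else 0)"
    unfolding extend_bilinear_nth using assms(2)
    by (intro sum.cong) (auto simp: additive.zero[OF assms(1)])
  then show ?thesis by simp
qed

section \<open>Identities of the undeformed algebra on power series\<close>

text \<open>The sum over all triples with \<open>i + j + k = n\<close> is symmetric in the three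
  indices, which allows the cyclic permutations needed for the Jacobi identity.\<close>

lemma extend_bilinear_nested_nth:
  assumes "\<And>x. additive (m x)"
  shows "extend_bilinear m x (extend_bilinear m y z) $ n =
    (\<Sum>(i, j, k) | i + j + k = n. m (x $ i) (m (y $ j) (z $ k)))"
proof -
  have "(\<Sum>i\<le>n. \<Sum>j\<le>n - i. m (x $ i) (m (y $ j) (z $ (n - i - j)))) =
      (\<Sum>(i, j, k) | i + j + k = n. m (x $ i) (m (y $ j) (z $ k)))"
    unfolding sum.Sigma[OF finite_atMost ballI[OF finite_atMost]]
    by (rule sum.reindex_bij_witness
        [of _ "\<lambda>(i, j, k). (i, j)" "\<lambda>(i, j). (i, j, n - i - j)"]) auto
  then show ?thesis
    by (simp add: extend_bilinear_nth additive.sum[OF assms])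
qed

lemma extend_bilinear_jacobi:
  assumes "\<And>x. additive (m x)"
    and jacobi: "\<And>x y z. m x (m y z) + m y (m z x) + m z (m x y) = 0"
  shows "extend_bilinear m x (extend_bilinear m y z) + extend_bilinear m y (extend_bilinear m z x) +
    extend_bilinear m z (extend_bilinear m x y) = 0"
proof (rule fps_ext)
  fix n
  have "(\<Sum>(i, j, k) | i + j + k = n. m (y $ i) (m (z $ j) (x $ k))) =
      (\<Sum>(i, j, k) | i + j + k = n. m (y $ j) (m (z $ k) (x $ i)))"
    by (rule sum.reindex_bij_witness[of _ "\<lambda>(i, j, k). (j, k, i)" "\<lambda>(j, k, i). (i, j, k)"]) auto
  moreover have "(\<Sum>(i, j, k) | i + j + k = n. m (z $ i) (m (x $ j) (y $ k))) =
      (\<Sum>(i, j, k) | i + j + k = n. m (z $ k) (m (x $ i) (y $ j)))"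
    by (rule sum.reindex_bij_witness[of _ "\<lambda>(i, j, k). (k, i, j)" "\<lambda>(k, i, j). (i, j, k)"]) auto
  ultimately show "(extend_bilinear m x (extend_bilinear m y z) +
      extend_bilinear m y (extend_bilinear m z x) + extend_bilinear m z (extend_bilinear m x y)) $ n =
      0 $ n"
    by (simp add: extend_bilinear_nested_nth assms(1) case_prod_beta jacobi flip: sum.distrib)
qed

lemma extend_linear_derivation:
  assumes "module scale" and "additive d"
    and "\<And>x y. d (m x y) = m (d x) y + m x (d y) + scale c (m (d x) (d y))"
  shows "extend_linear d (extend_bilinear m x y) =
    extend_bilinear m (extend_linear d x) y + extend_bilinear m x (extend_linear d y) +
    fps_scale scale (fps_const c) (extend_bilinear m (extend_linear d x) (extend_linear d y))"
proof -
  interpret module scale by fact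
  show ?thesis
    by (rule fps_ext) (simp add: extend_linear_nth extend_bilinear_nth additive.sum[OF assms(2)]
        fps_scale_const_nth assms(1,3) sum.distrib scale_sum_right)
qed

lemma linear_series_fps_scale_const:
  assumes "\<And>i. module_hom scale scale (f i)"
  shows "linear_series f (fps_scale scale (fps_const c) x) =
    fps_scale scale (fps_const c) (linear_series f x)"
proof -
  interpret module scale
    using assms[of 0] by (simp add: module_hom_iff)
  show ?thesis
    by (rule fps_ext) (simp add: linear_series_nth fps_scale_const_nth module_axioms
        module_hom.scale[OF assms] scale_sum_right)
qed

lemma module_hom_additive: "module_hom scale scale f \<Longrightarrow> additive f"
  by (simp add: module_hom_iff additive_def)

lemma fps_scale_const_add:
  assumes "module scale"
  shows "fps_scale scale (fps_const c) (x + y) =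
    fps_scale scale (fps_const c) x + fps_scale scale (fps_const c) y"
proof -
  interpret module scale by fact
  show ?thesis
    by (rule fps_ext) (simp add: fps_scale_const_nth module_axioms scale_right_distrib)
qed

section \<open>Cochains of low degree\<close>

definition cochain1 :: "('g::ab_group_add \<Rightarrow> 'g) \<Rightarrow> 'g list \<Rightarrow> 'g" where
  "cochain1 f xs = (if length xs = 1 then f (xs ! 0) else 0)"

definition cochain2 :: "('g::ab_group_add \<Rightarrow> 'g \<Rightarrow> 'g) \<Rightarrow> 'g list \<Rightarrow> 'g" where
  "cochain2 f xs = (if length xs = 2 then f (xs ! 0) (xs ! 1) else 0)"

lemma cochain1_in_alt_maps:
  assumes "module_hom scale scale f"
  shows "cochain1 f \<in> alt_maps scale 1"
  using assms by (auto simp: alt_maps_def cochain1_def)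

lemma cochain2_in_alt_maps:
  assumes "alt_bilinear scale f"
  shows "cochain2 f \<in> alt_maps scale 2"
proof -
  have "module_hom scale scale (\<lambda>x. cochain2 f (xs[i := x]))" if "length xs = 2" "i < 2" for xs i
    using that assms by (cases "i = 0") (auto simp: cochain2_def alt_bilinear_def less_2_cases_iff)
  then show ?thesis
    using assms by (auto simp: alt_maps_def cochain2_def alt_bilinear_def less_2_cases_iff)
qed

lemma alt_bilinear_swap:
  assumes "alt_bilinear scale m"
  shows "m x y = - m y x"
proof -
  have self: "m z z = 0" for z
    using assms by (simp add: alt_bilinear_def)
  have add: "m u (v + w) = m u v + m u w" "m (v + w) u = m v u + m w u" for u v w
    using assms by (simp_all add: alt_bilinear_def module_hom_iff)
  have "m x y + m y x = m x x + m x y + (m y x + m y y)"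
    by (simp add: self)
  also have "\<dots> = m (x + y) (x + y)"
    by (simp only: add ac_simps)
  finally show ?thesis
    by (simp add: self eq_neg_iff_add_eq_0)
qed

lemma alt_maps_1_module_hom:
  assumes "f \<in> alt_maps scale 1"
  shows "module_hom scale scale (\<lambda>x. f [x])"
proof -
  have "length xs = 1 \<longrightarrow> i < 1 \<longrightarrow> module_hom scale scale (\<lambda>x. f (xs[i := x]))" for xs i
    using assms by (simp add: alt_maps_def)
  \<comment> \<open>Overwriting the only entry of a list of length 1 gives \<open>[x]\<close>,
    whatever the entry was.\<close>
  from this[of "[0]" 0] show ?thesis by simp
qed

context vector_space
begin

lemma ce_diff_1:
  "ce_diff scale br \<rho> 1 f [x, y] = \<rho> x (f [y]) - \<rho> y (f [x]) - f [br x y]"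
  by (simp add: ce_diff_def nths_Cons)

lemma ce_diff_2:
  "ce_diff scale br \<rho> 2 f [x, y, z] =
    - \<rho> x (f [y, z]) + \<rho> y (f [x, z]) - \<rho> z (f [x, y])
    + f [br x y, z] - f [br x z, y] + f [br y z, x]"
  by (simp add: ce_diff_def nths_Cons eval_nat_numeral algebra_simps)

lemma delta_1: "delta scale lam d 1 f [x] = f [d x] - d (f [x])"
proof -
  have "{I. I \<subseteq> {..<1::nat} \<and> card I = 1} = {{0}}"
    by (auto simp: lessThan_Suc subset_singleton_iff)
  then show ?thesis
    by (simp add: delta_def)
qed

lemma delta_2:
  "delta scale lam d 2 f [x, y] =
    f [d x, y] + f [x, d y] + scale lam (f [d x, d y]) - d (f [x, y])"
proof -
  \<comment> \<open>The inner sum of \<open>delta\<close> ranges over subsets of {0, 1} of given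
    size; they are found by filtering the explicit power set.\<close>
  have Pow: "Pow {..<2::nat} = {{}, {0}, {1}, {0, 1}}"
    by (simp add: numeral_2_eq_2 lessThan_Suc Pow_insert insert_commute)
  have Pow': "{I. I \<subseteq> {..<2::nat} \<and> card I = k} = {I \<in> Pow {..<2}. card I = k}" for k
    by (simp only: Pow_iff)
  have 1: "{I. I \<subseteq> {..<2::nat} \<and> card I = 1} = {{0}, {1}}"
    unfolding Pow' Pow by auto
  have 2: "{I. I \<subseteq> {..<2::nat} \<and> card I = 2} = {{0, 1}}"
    unfolding Pow' Pow by auto
  have 4: "[0..<2] = [0, 1::nat]" by (simp add: numeral_2_eq_2)
  have 5: "(\<Sum>k = 1..2. h k) = h 1 + h 2" for h :: "nat \<Rightarrow> 'b"
    by (simp add: numeral_2_eq_2)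
  show ?thesis
    unfolding delta_def 4 5 1 2
    by (simp add: add.commute)
qed

end

section \<open>The obstruction to extending an equivalence by one order\<close>

text \<open>The coefficients of \<open>t\<^sup>n\<close> in \<open>\<Phi>\<^sub>t \<circ> \<mu>\<^sub>t - [,] \<circ> (\<Phi>\<^sub>t \<times> \<Phi>\<^sub>t)\<close> and
  \<open>\<Phi>\<^sub>t \<circ> d\<^sub>t - d \<circ> \<Phi>\<^sub>t\<close>.\<close>

definition bracket_defect ::
    "('g::ab_group_add \<Rightarrow> 'g \<Rightarrow> 'g) \<Rightarrow> (nat \<Rightarrow> 'g \<Rightarrow> 'g \<Rightarrow> 'g) \<Rightarrow> (nat \<Rightarrow> 'g \<Rightarrow> 'g) \<Rightarrow>
     nat \<Rightarrow> 'g \<Rightarrow> 'g \<Rightarrow> 'g" where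
  "bracket_defect bracket \<mu> \<phi> n x y =
     (\<Sum>i\<le>n. \<phi> i (\<mu> (n - i) x y)) - (\<Sum>i\<le>n. bracket (\<phi> i x) (\<phi> (n - i) y))"

definition diff_defect ::
    "('g::ab_group_add \<Rightarrow> 'g) \<Rightarrow> (nat \<Rightarrow> 'g \<Rightarrow> 'g) \<Rightarrow> (nat \<Rightarrow> 'g \<Rightarrow> 'g) \<Rightarrow> nat \<Rightarrow> 'g \<Rightarrow> 'g" where
  "diff_defect d dt \<phi> n x = (\<Sum>i\<le>n. \<phi> i (dt (n - i) x)) - d (\<phi> n x)"

section \<open>The deformed algebra and its defects\<close>

locale deformed_differential_lie_algebra = differential_lie_algebra scale bracket lam d
  for scale :: "'k::field_char_0 \<Rightarrow> 'g::ab_group_add \<Rightarrow> 'g" and bracket lam d +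
  fixes \<mu> :: "nat \<Rightarrow> 'g \<Rightarrow> 'g \<Rightarrow> 'g" and dt :: "nat \<Rightarrow> 'g \<Rightarrow> 'g"
  assumes deformation: "formal_deformation scale bracket lam d \<mu> dt"
begin

sublocale hom: module_pair scale scale ..

lemma vector_space_scale: "vector_space scale"
  by unfold_locales (simp_all add: scale_right_distrib scale_left_distrib)

lemma mu_0 [simp]: "\<mu> 0 = bracket" and dt_0 [simp]: "dt 0 = d"
  using deformation by (auto simp: formal_deformation_def)

lemma linear_dt: "module_hom scale scale (dt i)"
  and linear_mu_right: "module_hom scale scale (\<mu> i x)"
  and linear_mu_left: "module_hom scale scale (\<lambda>x. \<mu> i x y)"
  and mu_self [simp]: "\<mu> i x x = 0"
  using deformation by (auto simp: formal_deformation_def alt_bilinear_def)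

lemma linear_bracket_right: "module_hom scale scale (bracket x)"
  and linear_bracket_left: "module_hom scale scale (\<lambda>x. bracket x y)"
  using linear_mu_right[of 0] linear_mu_left[of 0] by simp_all

lemmas bracket_add_left = module_hom.add[OF linear_bracket_left]
  and bracket_minus_right = module_hom.neg[OF linear_bracket_right]
  and bracket_scale_left = module_hom.scale[OF linear_bracket_left]

lemmas bracket_swap = alt_bilinear_swap[OF alt_bilinear_bracket]

lemmas additive_d = module_hom_additive[OF linear_d]
  and additive_bracket_right = module_hom_additive[OF linear_bracket_right]
  and additive_bracket_left = module_hom_additive[OF linear_bracket_left]

abbreviation "M \<equiv> bilinear_series \<mu>"
abbreviation "D \<equiv> linear_series dt"
abbreviation "B \<equiv> extend_bilinear bracket"
abbreviation "D0 \<equiv> extend_linear d"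
abbreviation "S \<equiv> fps_scale scale (fps_const lam)"

lemma deformed_jacobi: "M x (M y z) + M y (M z x) + M z (M x y) = 0"
  and deformed_derivation: "D (M x y) = M (D x) y + M x (D y) + S (M (D x) (D y))"
proof -
  interpret t: differential_lie_algebra "fps_scale scale" M "fps_const lam" D
    using deformation by (simp add: formal_deformation_def)
  show "M x (M y z) + M y (M z x) + M z (M x y) = 0"
    by (rule t.jacobi)
  show "D (M x y) = M (D x) y + M x (D y) + S (M (D x) (D y))"
    by (rule t.d_bracket)
qed

text \<open>Linearity is inherited from the summands. On the diagonal the \<open>\<mu>\<close> part
  vanishes termwise, and the reflection of \<open>i\<close> to \<open>n - i\<close> together with
  antisymmetry gives \<open>s = - s\<close> for the bracket part, hence \<open>s = 0\<close> in
  characteristic 0.\<close>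

lemma alt_bilinear_bracket_defect:
  assumes lin: "\<And>i. module_hom scale scale (\<phi> i)"
  shows "alt_bilinear scale (bracket_defect bracket \<mu> \<phi> n)"
  unfolding alt_bilinear_def
proof (intro conjI allI)
  note comp = module_hom_compose[unfolded o_def]
  show "module_hom scale scale (bracket_defect bracket \<mu> \<phi> n x)" for x
    unfolding bracket_defect_def
    by (intro hom.module_hom_sub hom.module_hom_sum comp[OF linear_mu_right lin]
        comp[OF lin linear_bracket_right]) (auto simp: module_axioms)
  show "module_hom scale scale (\<lambda>x. bracket_defect bracket \<mu> \<phi> n x y)" for y
    unfolding bracket_defect_def
    by (intro hom.module_hom_sub hom.module_hom_sum comp[OF linear_mu_left lin]
        comp[OF lin linear_bracket_left]) (auto simp: module_axioms)
  show "bracket_defect bracket \<mu> \<phi> n x x = 0" for x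
  proof -
    define s where "s = (\<Sum>i\<le>n. bracket (\<phi> i x) (\<phi> (n - i) x))"
    have "s = (\<Sum>i\<le>n. bracket (\<phi> (n - i) x) (\<phi> i x))"
      unfolding s_def by (rule sum.reindex_bij_witness[of _ "\<lambda>i. n - i" "\<lambda>i. n - i"]) auto
    also have "\<dots> = - s"
      unfolding s_def sum_negf[symmetric] by (rule sum.cong[OF refl bracket_swap])
    finally have "scale 2 s = 0"
      by (metis add.right_inverse one_add_one scale_left_distrib scale_one)
    then have "s = 0" by (simp add: vector_space.scale_eq_0_iff[OF vector_space_scale])
    then show ?thesis
      by (simp add: bracket_defect_def s_def module_hom.zero[OF lin])
  qed
qed

lemma linear_diff_defect:
  assumes lin: "\<And>i. module_hom scale scale (\<phi> i)"
  shows "module_hom scale scale (diff_defect d dt \<phi> n)"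
proof -
  note comp = module_hom_compose[unfolded o_def]
  show ?thesis
    unfolding diff_defect_def
    by (intro hom.module_hom_sub hom.module_hom_sum comp[OF linear_dt lin] comp[OF lin linear_d])
      (auto simp: module_axioms)
qed

text \<open>The defects are by construction the coefficients of the difference of two bilinear
  series. This yields the rule for moving \<open>linear_series \<phi>\<close> inside
  \<open>M\<close> at the cost of one error term.\<close>

lemma series_bracket:
  assumes "\<And>i. module_hom scale scale (\<phi> i)"
  shows "linear_series \<phi> (M x y) =
    B (linear_series \<phi> x) (linear_series \<phi> y) + bilinear_series (bracket_defect bracket \<mu> \<phi>) x y"
  unfolding bracket_defect_def bilinear_series_diff
  using module_hom_additive[OF assms] additive_bracket_left additive_bracket_right
  by (simp add: linear_series_bilinear_series extend_bilinear_linear_series)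

lemma series_diff:
  assumes "\<And>i. module_hom scale scale (\<phi> i)"
  shows "linear_series \<phi> (D x) =
    D0 (linear_series \<phi> x) + linear_series (diff_defect d dt \<phi>) x"
  unfolding diff_defect_def linear_series_diff
  using module_hom_additive[OF assms] additive_d
  by (simp add: linear_series_linear_series extend_linear_linear_series)

section \<open>Cocycle and coboundary equations in the first order with a defect\<close>

context
  fixes \<phi> :: "nat \<Rightarrow> 'g \<Rightarrow> 'g" and n :: nat
  assumes lin: "\<And>i. module_hom scale scale (\<phi> i)"
    and phi_0: "\<phi> 0 = id"
    and n_pos: "0 < n"
    and bracket_defect_below: "\<And>i x y. i < n \<Longrightarrow> bracket_defect bracket \<mu> \<phi> i x y = 0"
    and diff_defect_below: "\<And>i x. i < n \<Longrightarrow> diff_defect d dt \<phi> i x = 0"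
begin

abbreviation "F \<equiv> linear_series \<phi>"
abbreviation "E \<equiv> bilinear_series (bracket_defect bracket \<mu> \<phi>)"
abbreviation "G \<equiv> linear_series (diff_defect d dt \<phi>)"
abbreviation "e \<equiv> bracket_defect bracket \<mu> \<phi> n"
abbreviation "g \<equiv> diff_defect d dt \<phi> n"

lemma F_0: "F x $ 0 = x $ 0"
  by (simp add: linear_series_nth phi_0)

lemma F_add: "F (x + y) = F x + F y"
  by (rule linear_series_add) (rule module_hom_additive[OF lin])

lemma E_nth: "E x y $ n = e (x $ 0) (y $ 0)"
  using bracket_defect_below by (rule bilinear_series_lowest_nth)

lemma G_nth: "G x $ n = g (x $ 0)"
  using diff_defect_below by (rule linear_series_lowest_nth)

lemma E_below: "i < n \<Longrightarrow> E x y $ i = 0"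
  using bracket_defect_below by (rule bilinear_series_below_nth)

lemma G_below: "i < n \<Longrightarrow> G x $ i = 0"
  using diff_defect_below by (rule linear_series_below_nth)

lemma B_right_nth: "(\<And>i. i < n \<Longrightarrow> y $ i = 0) \<Longrightarrow> B x y $ n = bracket (x $ 0) (y $ n)"
  using additive_bracket_right by (rule extend_bilinear_lowest_right_nth)

lemma B_left_nth: "(\<And>i. i < n \<Longrightarrow> x $ i = 0) \<Longrightarrow> B x y $ n = bracket (x $ n) (y $ 0)"
  using additive_bracket_left by (rule extend_bilinear_lowest_left_nth)

lemmas B_add = extend_bilinear_add_left[OF additive_bracket_left]
  extend_bilinear_add_right[OF additive_bracket_right]

lemma M_0: "M x y $ 0 = bracket (x $ 0) (y $ 0)"
  by (simp add: bilinear_series_nth)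

lemma D_0: "D x $ 0 = d (x $ 0)"
  by (simp add: linear_series_nth)

text \<open>Applying \<open>F\<close> to the deformed Jacobi identity leaves a Jacobi sum for
  \<open>B\<close>, which is zero, and terms containing \<open>E\<close>. Their coefficient of order
  \<open>n\<close> is the claim.\<close>

lemma bracket_defect_cocycle:
  "e x (bracket y z) + e y (bracket z x) + e z (bracket x y) +
   (bracket x (e y z) + bracket y (e z x) + bracket z (e x y)) = 0"
proof -
  \<comment> \<open>Constant series suffice, because the coefficient of order \<open>n\<close> of
    the error terms depends only on the constant coefficients of the arguments.\<close>
  define X Y Z where "X = fps_const x" and "Y = fps_const y" and "Z = fps_const z"
  have [simp]: "X $ 0 = x" "Y $ 0 = y" "Z $ 0 = z"
    by (simp_all add: X_def Y_def Z_def)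
  have FMM: "F (M u (M v w)) = B (F u) (B (F v) (F w)) + (B (F u) (E v w) + E u (M v w))" for u v w
    by (simp add: series_bracket[OF lin] B_add add.assoc)
  have "F (M X (M Y Z)) + F (M Y (M Z X)) + F (M Z (M X Y)) = F 0"
    by (simp only: deformed_jacobi flip: F_add)
  also have "F 0 = 0"
    using F_add[of 0 0] by simp
  finally have "(B (F X) (B (F Y) (F Z)) + B (F Y) (B (F Z) (F X)) + B (F Z) (B (F X) (F Y))) +
      ((B (F X) (E Y Z) + E X (M Y Z)) + (B (F Y) (E Z X) + E Y (M Z X)) +
       (B (F Z) (E X Y) + E Z (M X Y))) = 0"
    by (simp only: FMM ac_simps)
  then have "((B (F X) (E Y Z) + E X (M Y Z)) + (B (F Y) (E Z X) + E Y (M Z X)) +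
       (B (F Z) (E X Y) + E Z (M X Y))) $ n = 0"
    by (simp add: extend_bilinear_jacobi[OF additive_bracket_right jacobi])
  then show ?thesis
    \<comment> \<open>Since \<open>E\<close> starts in order \<open>n\<close>, the other factors
      enter through their constant coefficients, where \<open>F\<close> is the identity and
      \<open>M\<close> is the bracket.\<close>
    by (simp add: B_right_nth E_below E_nth M_0 F_0 ac_simps)
qed

text \<open>The same comparison for the deformed derivation identity: both sides are pushed through
  \<open>F\<close>, and the parts free of \<open>E\<close> and \<open>G\<close> agree because
  \<open>d\<close> is a derivation of weight \<open>lam\<close>.\<close>

lemma diff_defect_cocycle:
  "g (bracket x y) + d (e x y) =
    e (d x) y + bracket (g x) y + (e x (d y) + bracket x (g y)) +
    scale lam (e (d x) (d y) + bracket (g x) (d y) + bracket (d x) (g y))"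
proof -
  define X Y where "X = fps_const x" and "Y = fps_const y"
  have [simp]: "X $ 0 = x" "Y $ 0 = y"
    by (simp_all add: X_def Y_def)
  note S_add = fps_scale_const_add[OF module_axioms]
  \<comment> \<open>Both factors start in the positive order \<open>n\<close>, so the quadratic
    error term vanishes in order \<open>n\<close>.\<close>
  have GG: "B (G X) (G Y) $ n = 0"
    using n_pos by (simp add: B_left_nth G_below additive.zero[OF additive_bracket_right])
  have FDM: "F (D (M X Y)) = D0 (B (F X) (F Y)) + (D0 (E X Y) + G (M X Y))"
    by (simp add: series_diff[OF lin] series_bracket[OF lin] extend_linear_add[OF additive_d]
        add.assoc)
  have FMD: "F (M (D X) Y + M X (D Y) + S (M (D X) (D Y))) =
      (B (D0 (F X)) (F Y) + B (F X) (D0 (F Y)) + S (B (D0 (F X)) (D0 (F Y)))) +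
      ((B (G X) (F Y) + E (D X) Y) + (B (F X) (G Y) + E X (D Y)) +
       S (B (D0 (F X)) (G Y) + B (G X) (D0 (F Y)) + B (G X) (G Y) + E (D X) (D Y)))"
    by (simp add: F_add linear_series_fps_scale_const[OF lin] series_diff[OF lin]
        series_bracket[OF lin] B_add S_add ac_simps)
  have "D0 (E X Y) + G (M X Y) = (B (G X) (F Y) + E (D X) Y) + (B (F X) (G Y) + E X (D Y)) +
       S (B (D0 (F X)) (G Y) + B (G X) (D0 (F Y)) + B (G X) (G Y) + E (D X) (D Y))"
    using FDM FMD deformed_derivation[of X Y]
      extend_linear_derivation[where m = bracket, OF module_axioms additive_d d_bracket,
        of "F X" "F Y"]
    by (metis add_left_imp_eq)
  then have "(D0 (E X Y) + G (M X Y)) $ n =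
      ((B (G X) (F Y) + E (D X) Y) + (B (F X) (G Y) + E X (D Y)) +
       S (B (D0 (F X)) (G Y) + B (G X) (D0 (F Y)) + B (G X) (G Y) + E (D X) (D Y))) $ n"
    by (rule arg_cong)
  then show ?thesis
    by (simp add: GG B_right_nth B_left_nth E_below G_below E_nth G_nth M_0 D_0 F_0
        fps_scale_const_nth[OF module_axioms] extend_linear_nth ac_simps)
qed

text \<open>Up to sign the first component is the cyclic identity
  \<open>bracket_defect_cocycle\<close>. In the second, the action of \<open>x + lam d x\<close> in
  \<open>do_diff\<close> accounts for the mixed weighted terms of
  \<open>diff_defect_cocycle\<close>.\<close>

lemma defect_in_cocycles: "(cochain2 e, cochain1 g) \<in> DL_cocycles scale bracket lam d 2"
proof -
  have alt: "alt_bilinear scale e" and ling: "module_hom scale scale g"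
    using alt_bilinear_bracket_defect[OF lin] linear_diff_defect[OF lin] by auto
  have e_hom: "module_hom scale scale (e u)" for u
    using alt by (simp add: alt_bilinear_def)
  note e_swap = alt_bilinear_swap[OF alt]
  have "lie_diff scale bracket 2 (cochain2 e) xs = 0" for xs
  proof (cases "length xs = 3")
    case True
    then obtain x y z where xs: "xs = [x, y, z]"
      by (auto simp: numeral_3_eq_3 length_Suc_conv)
    \<comment> \<open>The differential keeps its arguments in increasing order while the cocycle
      identity is cyclic; antisymmetry reconciles the terms containing the pair \<open>x\<close>,
      \<open>z\<close>.\<close>
    have "bracket y (e x z) = - bracket y (e z x)"
      by (simp add: e_swap[of x z] bracket_minus_right)
    moreover have "e (bracket x z) y = e y (bracket z x)"
      by (simp add: e_swap[of _ y] bracket_swap[of x z] module_hom.neg[OF e_hom])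
    ultimately have "lie_diff scale bracket 2 (cochain2 e) xs =
        - (e x (bracket y z) + e y (bracket z x) + e z (bracket x y) +
           (bracket x (e y z) + bracket y (e z x) + bracket z (e x y)))"
      using e_swap[of "bracket x y" z] e_swap[of "bracket y z" x]
      by (simp add: xs lie_diff_def vector_space.ce_diff_2[OF vector_space_scale] cochain2_def)
    then show ?thesis
      by (simp only: bracket_defect_cocycle minus_zero)
  qed (simp add: lie_diff_def ce_diff_def)
  moreover have "- do_diff scale bracket lam d 1 (cochain1 g) xs -
      delta scale lam d 2 (cochain2 e) xs = 0" for xs
  proof (cases "length xs = 2")
    case True
    then obtain x y where xs: "xs = [x, y]"
      by (auto simp: numeral_2_eq_2 length_Suc_conv)
    show ?thesis
      unfolding xs do_diff_def vector_space.ce_diff_1[OF vector_space_scale]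
        vector_space.delta_2[OF vector_space_scale]
      using diff_defect_cocycle[of x y]
      by (simp add: cochain1_def cochain2_def bracket_add_left bracket_scale_left scale_right_distrib
          bracket_swap[of y "g x"] bracket_swap[of "d y" "g x"] algebra_simps)
  qed (simp add: do_diff_def ce_diff_def delta_def)
  ultimately have "DL_diff scale bracket lam d 2 (cochain2 e, cochain1 g) = 0"
    by (simp add: DL_diff_def zero_prod_def fun_eq_iff)
  then show ?thesis
    using cochain2_in_alt_maps[OF alt] cochain1_in_alt_maps[OF ling]
    by (simp add: DL_cocycles_def DL_cochains_def)
qed

text \<open>Vanishing cohomology says that the coset of the defect cocycle equals the set of
  coboundaries; as a coset contains its representative, the cocycle is a coboundary. Cochains of
  degree 1 have zero second component, so a single linear map \<open>a\<close> solves both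
  equations.\<close>

lemma coboundary_solution:
  assumes "DL_cohomology scale bracket lam d 2 = {DL_coboundaries scale bracket lam d 2}"
  obtains a where "module_hom scale scale a"
    and "\<And>x y. e x y = bracket x (a y) - bracket y (a x) - a (bracket x y)"
    and "\<And>x. g x = d (a x) - a (d x)"
proof -
  let ?B = "DL_coboundaries scale bracket lam d 2"
  have "0 \<in> DL_cochains scale 1"
    by (auto simp: DL_cochains_def alt_maps_def zero_prod_def hom.module_hom_zero)
  moreover have "DL_diff scale bracket lam d 1 0 = 0"
    by (auto simp: DL_diff_def zero_prod_def fun_eq_iff lie_diff_def do_diff_def ce_diff_def
        delta_def additive.zero[OF additive_bracket_right] additive.zero[OF additive_d])
  ultimately have "0 \<in> ?B"
    by (auto simp: DL_coboundaries_def intro: rev_image_eqI)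
  moreover have "(+) (cochain2 e, cochain1 g) ` ?B = ?B"
    using assms defect_in_cocycles unfolding DL_cohomology_def by blast
  ultimately have "(cochain2 e, cochain1 g) \<in> ?B"
    by (metis add.right_neutral imageI)
  then obtain f where f: "f \<in> alt_maps scale 1"
    and "(cochain2 e, cochain1 g) = DL_diff scale bracket lam d 1 (f, 0)"
    by (auto simp: DL_coboundaries_def DL_cochains_def)
  then have eq: "cochain2 e xs = lie_diff scale bracket 1 f xs"
    "cochain1 g xs = - do_diff scale bracket lam d 0 0 xs - delta scale lam d 1 f xs" for xs
    by (simp_all add: DL_diff_def)
  show thesis
  proof
    show "module_hom scale scale (\<lambda>x. f [x])"
      using f by (rule alt_maps_1_module_hom)
    show "e x y = bracket x (f [y]) - bracket y (f [x]) - f [bracket x y]" for x y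
      using eq(1)[of "[x, y]"]
      unfolding lie_diff_def vector_space.ce_diff_1[OF vector_space_scale]
      by (simp add: cochain2_def)
    show "g x = d (f [x]) - f [d x]" for x
      using eq(2)[of "[x]"]
      unfolding vector_space.delta_1[OF vector_space_scale]
      by (simp add: cochain1_def do_diff_def ce_diff_def additive.zero[OF additive_bracket_right])
  qed
qed

end

section \<open>Correction in order \<open>n\<close> and recursive choice of the equivalence\<close>

text \<open>Only the index \<open>n\<close> in the first sum and the two end indices in the second
  involve the new coefficient. These ends are distinct as \<open>0 < n\<close>, and the remaining
  factor there is \<open>\<phi> 0 = id\<close>.\<close>

lemma bracket_defect_update:
  assumes "0 < n" and lin: "\<And>i. module_hom scale scale (\<phi> i)" and "\<phi> 0 = id" and "\<phi> n = 0"
  shows "bracket_defect bracket \<mu> (\<phi>(n := a)) n x y =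
    bracket_defect bracket \<mu> \<phi> n x y + a (bracket x y) - bracket (a x) y - bracket x (a y)"
proof -
  let ?\<psi> = "\<phi>(n := a)"
  have [simp]: "\<phi> n u = 0" for u
    using assms(4) by simp
  have "(\<Sum>i\<le>n. ?\<psi> i (\<mu> (n - i) x y)) =
      (\<Sum>i\<le>n. \<phi> i (\<mu> (n - i) x y) + (if i = n then a (bracket x y) else 0))"
    by (intro sum.cong) auto
  moreover have "(\<Sum>i\<le>n. bracket (?\<psi> i x) (?\<psi> (n - i) y)) =
      (\<Sum>i\<le>n. bracket (\<phi> i x) (\<phi> (n - i) y) +
        (if i = n then bracket (a x) y else 0) + (if i = 0 then bracket x (a y) else 0))"
    using \<open>0 < n\<close> \<open>\<phi> 0 = id\<close>
    by (intro sum.cong) (auto simp: additive.zero[OF additive_bracket_right]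
        additive.zero[OF additive_bracket_left])
  ultimately show ?thesis
    by (simp add: bracket_defect_def sum.distrib algebra_simps)
qed

lemma diff_defect_update:
  assumes "\<phi> n = 0"
  shows "diff_defect d dt (\<phi>(n := a)) n x = diff_defect d dt \<phi> n x + a (d x) - d (a x)"
proof -
  have [simp]: "\<phi> n u = 0" for u
    using assms by simp
  have "(\<Sum>i\<le>n. (\<phi>(n := a)) i (dt (n - i) x)) =
      (\<Sum>i\<le>n. \<phi> i (dt (n - i) x) + (if i = n then a (d x) else 0))"
    by (intro sum.cong) auto
  then show ?thesis
    by (simp add: diff_defect_def sum.distrib additive.zero[OF additive_d])
qed

text \<open>Defects of order \<open>n\<close> see only coefficients up to \<open>n\<close>, so later
  choices cannot spoil orders already settled.\<close>

lemma defect_cong: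
  assumes "\<And>i. i \<le> n \<Longrightarrow> \<phi> i = \<psi> i"
  shows "bracket_defect bracket \<mu> \<phi> n = bracket_defect bracket \<mu> \<psi> n"
    and "diff_defect d dt \<phi> n = diff_defect d dt \<psi> n"
  unfolding bracket_defect_def diff_defect_def
  by (intro ext arg_cong2[where f = "(-)"] sum.cong refl; simp add: assms)+

lemma trivial_if_cohomology_zero:
  assumes H2: "DL_cohomology scale bracket lam d 2 = {DL_coboundaries scale bracket lam d 2}"
  shows "trivial_deformation scale bracket d \<mu> dt"
proof -
  \<comment> \<open>\<open>P \<phi> n r\<close> says that \<open>r\<close> is an admissible
    coefficient of order \<open>n\<close>. The update \<open>\<phi>(n := r)\<close> makes this
    depend only on \<open>r\<close> and the values of \<open>\<phi>\<close> below \<open>n\<close>,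
    as well-founded dependent choice requires.\<close>
  define P where "P \<phi> n r \<longleftrightarrow> module_hom scale scale r \<and> (n = 0 \<longrightarrow> r = id) \<and>
      bracket_defect bracket \<mu> (\<phi>(n := r)) n = 0 \<and> diff_defect d dt (\<phi>(n := r)) n = 0"
    for \<phi> :: "nat \<Rightarrow> 'g \<Rightarrow> 'g" and n r
  have "\<exists>\<phi>. \<forall>n. P \<phi> n (\<phi> n)"
  proof (rule dependent_wf_choice[OF wf_less])
    fix \<phi> \<psi> :: "nat \<Rightarrow> 'g \<Rightarrow> 'g" and n r
    assume "\<And>i. (i, n) \<in> {(i, n). i < n} \<Longrightarrow> \<phi> i = \<psi> i"
    then have "(\<phi>(n := r)) i = (\<psi>(n := r)) i" if "i \<le> n" for i
      using that by simp
    then show "P \<phi> n r = P \<psi> n r"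
      using defect_cong[of n "\<phi>(n := r)" "\<psi>(n := r)"] by (simp add: P_def)
  next
    fix n and \<phi> :: "nat \<Rightarrow> 'g \<Rightarrow> 'g"
    assume "\<And>i. (i, n) \<in> {(i, n). i < n} \<Longrightarrow> P \<phi> i (\<phi> i)"
    then have IH: "P \<phi> i (\<phi> i)" if "i < n" for i
      using that by simp
    show "\<exists>r. P \<phi> n r"
    proof (cases "n = 0")
      case True
      then have "P \<phi> n id"
        by (auto simp: P_def bracket_defect_def diff_defect_def fun_eq_iff module_hom_iff module_axioms)
      then show ?thesis by blast
    next
      case False
      \<comment> \<open>Nothing is known about \<open>\<phi>\<close> from order \<open>n\<close> on.
        Truncation makes all coefficients linear and supplies \<open>\<psi> n = 0\<close> for the
        update lemmas.\<close>
      define \<psi> where "\<psi> i = (if i < n then \<phi> i else 0)" for i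
      have lin: "module_hom scale scale (\<psi> i)" for i
        using IH[of i] hom.module_hom_zero by (auto simp: \<psi>_def P_def zero_fun_def)
      have psi_0: "\<psi> 0 = id" and psi_n: "\<psi> n = 0"
        using IH[of 0] False by (auto simp: \<psi>_def P_def)
      have below: "bracket_defect bracket \<mu> \<psi> i = 0" "diff_defect d dt \<psi> i = 0" if "i < n" for i
        using IH[OF that] that defect_cong[of i \<psi> \<phi>] by (auto simp: \<psi>_def P_def)
      obtain a where a: "module_hom scale scale a"
        "\<And>x y. bracket_defect bracket \<mu> \<psi> n x y = bracket x (a y) - bracket y (a x) - a (bracket x y)"
        "\<And>x. diff_defect d dt \<psi> n x = d (a x) - a (d x)"
        using coboundary_solution[of \<psi> n] lin psi_0 False below H2 by auto
      \<comment> \<open>The update adds exactly the negative of the coboundary of \<open>a\<close>,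
        once \<open>bracket y (a x)\<close> is rewritten as
        \<open>- bracket (a x) y\<close>.\<close>
      have "bracket_defect bracket \<mu> (\<psi>(n := a)) n = 0"
        using False by (intro ext) (simp add: bracket_defect_update lin psi_0 psi_n a(2)
            bracket_swap[of _ "a _"])
      moreover have "diff_defect d dt (\<psi>(n := a)) n = 0"
        by (intro ext) (simp add: diff_defect_update psi_n a(3))
      ultimately have "P \<phi> n a"
        using a(1) False defect_cong[of n "\<psi>(n := a)" "\<phi>(n := a)"]
        by (simp add: P_def \<psi>_def)
      then show ?thesis by blast
    qed
  qed
  then obtain \<phi> where "P \<phi> n (\<phi> n)" for n
    by blast
  then have lin: "module_hom scale scale (\<phi> n)" and "\<phi> 0 = id"
    and "bracket_defect bracket \<mu> \<phi> n = 0" and "diff_defect d dt \<phi> n = 0" for n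
    by (auto simp: P_def)
  \<comment> \<open>With all defects zero, the error series in \<open>series_bracket\<close> and
    \<open>series_diff\<close> vanish.\<close>
  moreover from this have "linear_series \<phi> (M x y) = B (linear_series \<phi> x) (linear_series \<phi> y)"
    and "linear_series \<phi> (D x) = D0 (linear_series \<phi> x)" for x y
    by (auto simp: series_bracket series_diff linear_series_nth bilinear_series_nth
        intro!: fps_ext)
  ultimately show ?thesis
    unfolding trivial_deformation_def by blast
qed

end

theorem theorem3p10:
  fixes scale :: "'k::field_char_0 \<Rightarrow> 'g::ab_group_add \<Rightarrow> 'g"
    and bracket :: "'g \<Rightarrow> 'g \<Rightarrow> 'g"
    and lam :: 'k
    and d :: "'g \<Rightarrow> 'g"
  assumes "differential_lie_algebra scale bracket lam d"
    and "DL_cohomology scale bracket lam d 2 = {DL_coboundaries scale bracket lam d 2}"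
  shows "rigid scale bracket lam d"
  unfolding rigid_def
proof (intro allI impI)
  fix \<mu> dt
  assume "formal_deformation scale bracket lam d \<mu> dt"
  then interpret deformed_differential_lie_algebra scale bracket lam d \<mu> dt
    using assms(1)
    by (simp add: deformed_differential_lie_algebra_def deformed_differential_lie_algebra_axioms_def)
  show "trivial_deformation scale bracket d \<mu> dt"
    using assms(2) by (rule trivial_if_cohomology_zero)
qed

end
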